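(* Let $2\leq k<n$ and let $K\subset\mathbb{C}^n$ be a convex body such that for every complex $k$-dimensional linear subspace $P\subset\mathbb{C}^n$, the orthogonal projection of $K$ onto $P$ is a (complex) ellipsoid in $P$. Then $K$ is an ellipsoid.
   Context: A convex body is a compact convex subset of $\mathbb{C}^n$ with nonempty interior. A (complex) ellipsoid in a complex affine space of dimension $m$ is the image of the closed Euclidean unit ball of $\mathbb{C}^m$ under an injective complex affine map into that space. Orthogonal projections are with respect to the standard Hermitian inner product on $\mathbb{C}^n$. *)

theory Defs
  imports "HOL-Analysis.Analysis" "HOL-Library.FuncSet"
begin

text \<open>C^n is modelled as complex^'n, n = CARD('n). Complex-linear notions use the
  library interpretation vec (scalar multiplication *s over the field complex).\<close>

definition herm_inner :: "complex^'n \<Rightarrow> complex^'n \<Rightarrow> complex" where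
  "herm_inner x y = (\<Sum>i\<in>UNIV. x$i * cnj (y$i))"

definition cproj :: "(complex^'n) set \<Rightarrow> complex^'n \<Rightarrow> complex^'n" where
  "cproj P x = (THE p. p \<in> P \<and> (\<forall>y\<in>P. herm_inner (x - p) y = 0))"

text \<open>E is a complex ellipsoid in the complex linear subspace P (of complex dimension m = vec.dim P):
  E is the image of the closed unit ball of C^m (functions on {..<m}) under an injective
  complex affine map z \<mapsto> c + sum_j z_j v_j from C^m into P.\<close>
definition complex_ellipsoid_in :: "(complex^'n) set \<Rightarrow> (complex^'n) set \<Rightarrow> bool" where
  "complex_ellipsoid_in P E \<longleftrightarrow>
     (\<exists>c (v :: nat \<Rightarrow> complex^'n).
        let m = vec.dim P;
            S = ({..<m} \<rightarrow>\<^sub>E (UNIV :: complex set));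
            f = (\<lambda>z. c + (\<Sum>j<m. z j *s v j))
        in c \<in> P \<and> (\<forall>j<m. v j \<in> P) \<and> inj_on f S \<and>
           E = f ` {z \<in> S. (\<Sum>j<m. (cmod (z j))\<^sup>2) \<le> 1})"

end

theory Submission
  imports Defs
begin

text \<open>The support function of the projection of \<open>K\<close> onto \<open>P\<close> is the restriction to \<open>P\<close> of the
  support function \<open>h\<close> of \<open>K\<close>, and the support function of an ellipsoid is the sum of a real linear
  functional and the square root of a positive definite Hermitian form. As \<open>k \<ge> 2\<close>, any two vectors
  lie in a common \<open>P\<close>, so the odd part of \<open>h\<close> is real linear, and the square of the even part obeys
  the parallelogram law and is Hermitian on each complex plane; by Jordan and von Neumann it is a
  Hermitian form on the whole space. An orthonormal basis for this form and its dual basis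
  exhibit the convex set with support function \<open>h\<close> as an ellipsoid.\<close>

section \<open>The Hermitian inner product\<close>

lemma herm_inner_add_left: "herm_inner (x + y) z = herm_inner x z + herm_inner y z"
  by (simp add: herm_inner_def distrib_right sum.distrib)

lemma herm_inner_scale_left: "herm_inner (a *s x) z = a * herm_inner x z"
  by (simp add: herm_inner_def sum_distrib_left mult.assoc)

lemma herm_inner_commute: "herm_inner x y = cnj (herm_inner y x)"
  by (simp add: herm_inner_def mult.commute)

lemma herm_inner_scale_right: "herm_inner x (a *s y) = cnj a * herm_inner x y"
  by (metis herm_inner_commute herm_inner_scale_left complex_cnj_mult)

lemma herm_inner_diff_left: "herm_inner (x - y) z = herm_inner x z - herm_inner y z"
  by (simp add: herm_inner_def left_diff_distrib sum_subtractf)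

lemma herm_inner_zero_left [simp]: "herm_inner 0 z = 0"
  by (simp add: herm_inner_def)

lemma herm_inner_sum_left: "herm_inner (\<Sum>i\<in>A. f i) z = (\<Sum>i\<in>A. herm_inner (f i) z)"
  by (induction A rule: infinite_finite_induct) (simp_all add: herm_inner_add_left)

lemma herm_inner_sum_right: "herm_inner z (\<Sum>i\<in>A. f i) = (\<Sum>i\<in>A. herm_inner z (f i))"
  by (subst herm_inner_commute, subst herm_inner_sum_left)
     (simp add: herm_inner_commute[of z])

lemma Re_herm_inner: "Re (herm_inner x y) = x \<bullet> y"
  by (simp add: herm_inner_def inner_vec_def inner_complex_def)

lemma scaleR_eq_scale_of_real: "r *\<^sub>R x = complex_of_real r *s (x :: complex^'n)"
  unfolding vec_eq_iff by (simp add: scaleR_conv_of_real[of r "_::complex"])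

text \<open>A complex subspace is closed under multiplication by \<open>\<i>\<close>, and testing
  against \<open>\<i> *s y\<close> turns the imaginary part into a real one. Real orthogonality
  therefore suffices, and the real theory of projections applies.\<close>

lemma herm_inner_eq_0_if_inner:
  assumes P: "vec.subspace P" and x: "\<And>y. y \<in> P \<Longrightarrow> x \<bullet> y = 0" and y: "y \<in> P"
  shows "herm_inner x y = 0"
proof (rule complex_eqI)
  show "Re (herm_inner x y) = Re 0"
    using x[OF y] by (simp add: Re_herm_inner)
  have "\<i> *s y \<in> P"
    using P y by (rule vec.subspace_scale)
  then have "Re (herm_inner x (\<i> *s y)) = 0"
    using x by (simp add: Re_herm_inner)
  then show "Im (herm_inner x y) = Im 0"
    by (simp add: herm_inner_scale_right)
qed

text \<open>Justifies the definite description in \<open>cproj\<close>: existence comes from the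
  real orthogonal decomposition, uniqueness because the difference of two candidates is orthogonal
  to itself.\<close>

lemma cproj_orthogonal:
  fixes x :: "complex^'n"
  assumes P: "vec.subspace P"
  shows "cproj P x \<in> P" "\<And>y. y \<in> P \<Longrightarrow> herm_inner (x - cproj P x) y = 0"
proof -
  have sub: "subspace P"
    using P by (auto simp: subspace_def vec.subspace_def scaleR_eq_scale_of_real)
  have "\<exists>!p. p \<in> P \<and> (\<forall>y\<in>P. herm_inner (x - p) y = 0)"
  proof (rule ex_ex1I)
    obtain p z where pz: "p \<in> span P" "\<And>w. w \<in> span P \<Longrightarrow> orthogonal z w" "x = p + z"
      using orthogonal_subspace_decomp_exists[of P x] by metis
    have "p \<in> P" using pz(1) sub by (simp add: span_eq_iff[THEN iffD2])
    moreover have "herm_inner (x - p) y = 0" if "y \<in> P" for y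
      using P _ that
    proof (rule herm_inner_eq_0_if_inner)
      fix w assume "w \<in> P"
      then show "(x - p) \<bullet> w = 0"
        using pz(2)[of w] pz(3) by (simp add: orthogonal_def span_base)
    qed
    ultimately show "\<exists>p. p \<in> P \<and> (\<forall>y\<in>P. herm_inner (x - p) y = 0)" by blast
  next
    fix p q
    assume p: "p \<in> P \<and> (\<forall>y\<in>P. herm_inner (x - p) y = 0)"
      and q: "q \<in> P \<and> (\<forall>y\<in>P. herm_inner (x - q) y = 0)"
    have "p - q \<in> P" using P p q by (simp add: vec.subspace_diff)
    then have "herm_inner (x - q) (p - q) - herm_inner (x - p) (p - q) = 0"
      using p q by simp
    then have "herm_inner (p - q) (p - q) = 0"
      by (simp add: herm_inner_diff_left[symmetric])
    then have "(p - q) \<bullet> (p - q) = 0"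
      by (metis Re_herm_inner zero_complex.sel(1))
    then show "p = q" by simp
  qed
  from theI'[OF this] show "cproj P x \<in> P" "\<And>y. y \<in> P \<Longrightarrow> herm_inner (x - cproj P x) y = 0"
    by (auto simp: cproj_def)
qed

lemma inner_cproj:
  assumes "vec.subspace P" "u \<in> P"
  shows "cproj P x \<bullet> u = x \<bullet> u"
proof -
  have "Re (herm_inner (x - cproj P x) u) = 0"
    using cproj_orthogonal(2)[OF assms] by simp
  then show ?thesis
    unfolding Re_herm_inner by (simp add: inner_diff_left)
qed

section \<open>Support functions\<close>

definition support_fun :: "('a::real_inner) set \<Rightarrow> 'a \<Rightarrow> real" where
  "support_fun K u = (SUP x\<in>K. x \<bullet> u)"

text \<open>Projecting onto \<open>P\<close> does not change inner products with vectors of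
  \<open>P\<close>, so both suprema range over the same set of reals.\<close>

lemma support_fun_cproj:
  assumes "vec.subspace P" "u \<in> P"
  shows "support_fun (cproj P ` K) u = support_fun K u"
  using inner_cproj[OF assms] by (simp add: support_fun_def image_image)

lemma inner_le_support_fun:
  fixes K :: "'a::real_inner set"
  assumes "compact K" "x \<in> K"
  shows "x \<bullet> u \<le> support_fun K u"
proof -
  have "compact ((\<lambda>x. x \<bullet> u) ` K)"
    using assms(1) by (intro compact_continuous_image continuous_intros)
  then show ?thesis
    unfolding support_fun_def using assms(2)
    by (intro cSUP_upper bounded_imp_bdd_above compact_imp_bounded) auto
qed

text \<open>Hyperplane separation: a point outside \<open>K\<close> violates the support inequality
  in the direction \<open>- a\<close>, where \<open>a\<close> is the separating normal.\<close>

lemma mem_if_inner_le_support_fun: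
  fixes K :: "'a::euclidean_space set"
  assumes "compact K" "convex K" "K \<noteq> {}" "\<And>u. x \<bullet> u \<le> support_fun K u"
  shows "x \<in> K"
proof (rule ccontr)
  assume "x \<notin> K"
  then obtain a b where ab: "a \<bullet> x < b" "\<And>y. y \<in> K \<Longrightarrow> b < a \<bullet> y"
    using separating_hyperplane_closed_point[of K x] assms compact_imp_closed by blast
  have "support_fun K (- a) \<le> - b"
    unfolding support_fun_def using assms(3) ab(2)
    by (intro cSUP_least) (auto simp: inner_commute intro: less_imp_le)
  moreover have "- b < x \<bullet> (- a)" using ab(1) by (simp add: inner_commute)
  ultimately show False using assms(4)[of "- a"] by linarith
qed

text \<open>Cauchy-Schwarz for the coefficients. It gives the upper bound for the support function
  of an ellipsoid, and later the easy inclusion when an ellipsoid is recovered from that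
  function.\<close>

lemma inner_combination_le:
  fixes v :: "nat \<Rightarrow> complex^'n" and z :: "nat \<Rightarrow> complex"
  assumes "(\<Sum>j<m. (cmod (z j))\<^sup>2) \<le> 1"
  shows "(\<Sum>j<m. z j *s v j) \<bullet> u \<le> sqrt (\<Sum>j<m. (cmod (herm_inner u (v j)))\<^sup>2)"
proof -
  have "(\<Sum>j<m. z j *s v j) \<bullet> u = Re (\<Sum>j<m. z j * herm_inner (v j) u)"
    by (simp add: Re_herm_inner[symmetric] herm_inner_sum_left herm_inner_scale_left)
  also have "\<dots> \<le> cmod (\<Sum>j<m. z j * herm_inner (v j) u)"
    by (rule complex_Re_le_cmod)
  also have "\<dots> \<le> (\<Sum>j<m. \<bar>cmod (z j)\<bar> * \<bar>cmod (herm_inner u (v j))\<bar>)"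
    by (rule order_trans[OF norm_sum])
       (simp add: norm_mult herm_inner_commute[of "v _" u])
  also have "\<dots> \<le> L2_set (\<lambda>j. cmod (z j)) {..<m} * L2_set (\<lambda>j. cmod (herm_inner u (v j))) {..<m}"
    by (rule L2_set_mult_ineq)
  also have "\<dots> \<le> 1 * L2_set (\<lambda>j. cmod (herm_inner u (v j))) {..<m}"
    using assms by (intro mult_right_mono) (simp_all add: L2_set_def sum_nonneg)
  finally show ?thesis by (simp add: L2_set_def)
qed

text \<open>The Cauchy-Schwarz bound is attained on the unit ball of coefficients, so the supremum
  is a maximum.\<close>

lemma support_fun_ellipsoid:
  fixes E :: "(complex^'n) set"
  assumes "complex_ellipsoid_in P E"
  obtains c and v :: "nat \<Rightarrow> complex^'n" where
    "\<And>u. support_fun E u = c \<bullet> u + sqrt (\<Sum>j<vec.dim P. (cmod (herm_inner u (v j)))\<^sup>2)"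
proof -
  define m where "m = vec.dim P"
  obtain c v where E: "E = (\<lambda>z. c + (\<Sum>j<m. z j *s v j)) `
      {z \<in> {..<m} \<rightarrow>\<^sub>E UNIV. (\<Sum>j<m. (cmod (z j))\<^sup>2) \<le> 1}"
    using assms unfolding complex_ellipsoid_in_def m_def Let_def by auto
  have "support_fun E u = c \<bullet> u + sqrt (\<Sum>j<m. (cmod (herm_inner u (v j)))\<^sup>2)" for u
  proof -
    define s where "s = (\<Sum>j<m. (cmod (herm_inner u (v j)))\<^sup>2)"
    have s0: "s \<ge> 0" by (simp add: s_def sum_nonneg)
    \<comment> \<open>The equality case of Cauchy-Schwarz. If \<open>s = 0\<close>, division by zero
      makes every coefficient 0, which still lies in the ball; hence the squared norm is written
      \<open>s / s\<close>, being 1 or 0.\<close>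
    define z where "z = (\<lambda>j\<in>{..<m}. herm_inner u (v j) / complex_of_real (sqrt s))"
    have z1: "(\<Sum>j<m. (cmod (z j))\<^sup>2) = s / s"
      using s0 by (simp add: z_def norm_divide power_divide s_def sum_divide_distrib[symmetric])
    have "(\<Sum>j<m. z j *s v j) \<bullet> u = Re (\<Sum>j<m. z j * herm_inner (v j) u)"
      by (simp add: Re_herm_inner[symmetric] herm_inner_sum_left herm_inner_scale_left)
    also have "(\<Sum>j<m. z j * herm_inner (v j) u) =
        (\<Sum>j<m. complex_of_real ((cmod (herm_inner u (v j)))\<^sup>2) / complex_of_real (sqrt s))"
      by (intro sum.cong refl)
         (simp add: z_def herm_inner_commute[of "v _" u] complex_norm_square del: of_real_power)
    also have "\<dots> = complex_of_real (s / sqrt s)"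
      by (simp add: s_def sum_divide_distrib)
    also have "Re \<dots> = sqrt s" using s0 by (simp add: real_div_sqrt)
    finally have z2: "(\<Sum>j<m. z j *s v j) \<bullet> u = sqrt s" .
    have zE: "c + (\<Sum>j<m. z j *s v j) \<in> E"
      unfolding E using z1 unfolding z_def
      by (intro imageI CollectI conjI restrict_PiE_iff[THEN iffD2]) auto
    show ?thesis
      unfolding support_fun_def s_def[symmetric]
    proof (rule cSup_eq_maximum)
      show "c \<bullet> u + sqrt s \<in> (\<lambda>x. x \<bullet> u) ` E"
        using zE z2 by (intro image_eqI[of _ _ "c + (\<Sum>j<m. z j *s v j)"])
          (simp_all add: inner_add_left)
    next
      fix y assume "y \<in> (\<lambda>x. x \<bullet> u) ` E"
      then show "y \<le> c \<bullet> u + sqrt s"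
        unfolding E s_def image_image image_iff mem_Collect_eq
        by (elim bexE) (simp add: inner_add_left inner_combination_le)
    qed
  qed
  then show thesis using that unfolding m_def by blast
qed

text \<open>A basis of the span of \<open>u\<close> and \<open>w\<close> has at most two elements,
  so some set of size \<open>k\<close> lies between it and an extension to a basis of the whole
  space. This is where \<open>k \<ge> 2\<close> enters.\<close>

lemma exists_subspace_containing_pair:
  fixes u w :: "complex^'n"
  assumes "2 \<le> k" "k \<le> CARD('n)"
  obtains P where "vec.subspace P" "vec.dim P = k" "u \<in> P" "w \<in> P"
proof -
  obtain B where B: "B \<subseteq> vec.span {u, w}" "vec.independent B" "vec.span {u, w} \<subseteq> vec.span B"
    "card B = vec.dim (vec.span {u, w})"
    using vec.basis_exists by blast
  have "vec.dim (vec.span {u, w}) \<le> card {u, w}"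
    by (rule vec.dim_le_card) auto
  also have "\<dots> \<le> 2" by (simp add: card_insert_if)
  finally have cB: "card B \<le> k" using B(4) assms by simp
  define C where "C = vec.extend_basis B"
  have C: "B \<subseteq> C" "vec.independent C" "vec.span C = UNIV"
    using B(2) by (auto simp: C_def vec.extend_basis_superset vec.independent_extend_basis
      vec.span_extend_basis)
  have "card C = CARD('n)"
    using C vec.dim_eq_card[of C UNIV] by (metis vec_dim_card vec.span_UNIV)
  moreover have "finite C" using C(2) vec.finiteI_independent by blast
  ultimately obtain T where T: "B \<subseteq> T" "T \<subseteq> C" "card T = k"
    using exists_subset_between[of B k C] cB assms C(1) by auto
  show thesis
  proof
    show "vec.subspace (vec.span T)" by simp
    show "vec.dim (vec.span T) = k"
      using T C(2) vec.dim_span_eq_card_independent vec.independent_mono by metis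
    have "vec.span B \<subseteq> vec.span T" using T by (intro vec.span_mono)
    then show "u \<in> vec.span T" "w \<in> vec.span T"
      using B(3) vec.span_base[of u "{u,w}"] vec.span_base[of w "{u,w}"] by auto
  qed
qed


section \<open>Positive definite Hermitian forms\<close>

text \<open>Conjugate linearity in the second argument follows from \<open>commute\<close>, which
  also makes \<open>G x x\<close> real, so \<open>pos\<close> can be stated with
  \<open>Re\<close>.\<close>

locale pos_herm_form =
  fixes G :: "complex^'n \<Rightarrow> complex^'n \<Rightarrow> complex"
  assumes add_left: "G (x + y) z = G x z + G y z"
    and scale_left: "G (a *s x) z = a * G x z"
    and commute: "G x y = cnj (G y x)"
    and pos: "x \<noteq> 0 \<Longrightarrow> Re (G x x) > 0"
begin

lemma zero_left [simp]: "G 0 z = 0"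
  using scale_left[of 0 0 z] by simp

lemma diff_left: "G (x - y) z = G x z - G y z"
  using add_left[of "x - y" y z] by simp

lemma sum_left: "G (\<Sum>i\<in>A. f i) z = (\<Sum>i\<in>A. G (f i) z)"
  by (induction A rule: infinite_finite_induct) (simp_all add: add_left)

lemma scale_right: "G x (a *s y) = cnj a * G x y"
  by (metis commute scale_left complex_cnj_mult)

lemma self_eq_Re: "G x x = complex_of_real (Re (G x x))"
  using commute[of x x] by (simp add: complex_eq_iff)

definition orthonormal :: "nat \<Rightarrow> (nat \<Rightarrow> complex^'n) \<Rightarrow> bool" where
  "orthonormal m w \<longleftrightarrow> (\<forall>i<m. \<forall>j<m. G (w i) (w j) = (if i = j then 1 else 0))"

lemma orthonormalD:
  "orthonormal m w \<Longrightarrow> i < m \<Longrightarrow> j < m \<Longrightarrow> G (w i) (w j) = (if i = j then 1 else 0)"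
  by (simp add: orthonormal_def)

lemma combination_orthonormal:
  assumes "orthonormal m w" "j < m"
  shows "G (\<Sum>i<m. a i *s w i) (w j) = a j"
proof -
  have "G (\<Sum>i<m. a i *s w i) (w j) = (\<Sum>i<m. if i = j then a i else 0)"
    using assms by (simp add: sum_left scale_left orthonormalD if_distrib cong: if_cong)
  then show ?thesis using assms(2) by simp
qed

lemma orthonormal_inj_on:
  assumes "orthonormal m w"
  shows "inj_on w {..<m}"
proof (rule inj_onI)
  fix i j assume "i \<in> {..<m}" "j \<in> {..<m}" "w i = w j"
  then show "i = j"
    using orthonormalD[OF assms, of i j] orthonormalD[OF assms, of j j]
    by (auto split: if_splits)
qed

lemma orthonormal_independent:
  assumes "orthonormal m w"
  shows "vec.independent (w ` {..<m})"
proof -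
  have "a (w j) = 0" if "(\<Sum>v\<in>w ` {..<m}. a v *s v) = 0" "j < m" for a j
  proof -
    have "(\<Sum>i<m. a (w i) *s w i) = 0"
      using that(1) by (simp add: sum.reindex[OF orthonormal_inj_on[OF assms]])
    then show ?thesis
      using combination_orthonormal[OF assms that(2), of "\<lambda>i. a (w i)"] by simp
  qed
  then show ?thesis by (subst vec.dependent_finite) auto
qed

text \<open>Gram-Schmidt: fewer than \<open>CARD('n)\<close> vectors do not span, so a vector
  outside their span can be made orthogonal to them and normalised.\<close>

lemma orthonormal_exists:
  "m \<le> CARD('n) \<Longrightarrow> \<exists>w. orthonormal m w"
proof (induction m)
  case 0
  then show ?case by (simp add: orthonormal_def)
next
  case (Suc m)
  then obtain w where w: "orthonormal m w" by auto
  have "vec.dim (vec.span (w ` {..<m})) \<le> card (w ` {..<m})"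
    by (rule vec.dim_le_card) auto
  also have "\<dots> \<le> m" using card_image_le[of "{..<m}" w] by simp
  finally have "vec.span (w ` {..<m}) \<noteq> UNIV"
    using Suc.prems by (metis Suc_le_eq not_le vec_dim_card)
  then obtain x where x: "x \<notin> vec.span (w ` {..<m})" by blast
  define p where "p = (\<Sum>i<m. G x (w i) *s w i)"
  define y where "y = x - p"
  have "p \<in> vec.span (w ` {..<m})"
    unfolding p_def by (intro vec.span_sum vec.span_scale vec.span_base) auto
  with x have "y \<noteq> 0" by (auto simp: y_def)
  define s where "s = Re (G y y)"
  have s: "s > 0" using pos[OF \<open>y \<noteq> 0\<close>] by (simp add: s_def)
  have yw: "G y (w j) = 0" if "j < m" for j
    using combination_orthonormal[OF w that, of "\<lambda>i. G x (w i)"]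
    by (simp add: y_def diff_left p_def)
  then have wy: "G (w j) y = 0" if "j < m" for j
    using that commute[of "w j" y] by simp
  define e where "e = complex_of_real (1 / sqrt s) *s y"
  have "G e e = complex_of_real (1 / sqrt s) * complex_of_real (1 / sqrt s) * complex_of_real s"
    using self_eq_Re[of y] by (simp add: e_def scale_left scale_right s_def)
  also have "\<dots> = complex_of_real (1 / sqrt s * (1 / sqrt s) * s)" by (simp only: of_real_mult)
  also have "1 / sqrt s * (1 / sqrt s) * s = 1" using s by (simp add: field_simps)
  finally have "G e e = 1" by simp
  then have "orthonormal (Suc m) (w(m := e))"
    using orthonormalD[OF w] yw wy
    by (auto simp: orthonormal_def less_Suc_eq e_def scale_left scale_right)
  then show ?case by blast
qed

lemma orthonormal_expansion:
  assumes w: "orthonormal CARD('n) w"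
  shows "u = (\<Sum>i<CARD('n). G u (w i) *s w i)"
proof -
  have "card (w ` {..<CARD('n)}) = CARD('n)"
    using card_image[OF orthonormal_inj_on[OF w]] by simp
  then have "UNIV \<subseteq> vec.span (w ` {..<CARD('n)})"
    using orthonormal_independent[OF w]
    by (intro vec.card_ge_dim_independent) (auto simp: card_cart_basis)
  then obtain a where "u = (\<Sum>v\<in>w ` {..<CARD('n)}. a v *s v)"
    by (subst (asm) vec.span_finite) auto
  then have u: "u = (\<Sum>i<CARD('n). a (w i) *s w i)"
    by (simp add: sum.reindex[OF orthonormal_inj_on[OF w]])
  have "G u (w i) = a (w i)" if "i < CARD('n)" for i
    using combination_orthonormal[OF w that, of "\<lambda>i. a (w i)"] u by simp
  then show ?thesis using u by simp
qed

text \<open>Parseval's identity for \<open>G\<close>.\<close>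

lemma form_orthonormal_expansion:
  assumes w: "orthonormal CARD('n) w"
  shows "Re (G u u) = (\<Sum>i<CARD('n). (cmod (G u (w i)))\<^sup>2)"
proof -
  have "G u u = (\<Sum>i<CARD('n). G u (w i) * G (w i) u)"
    \<comment> \<open>The \<open>arg_cong\<close> instance expands only the first argument of
      \<open>G u u\<close>; the second stays \<open>u\<close>.\<close>
    by (subst orthonormal_expansion[OF w, of u, THEN arg_cong[where f = "\<lambda>x. G x u"]])
       (simp add: sum_left scale_left)
  also have "\<dots> = (\<Sum>i<CARD('n). complex_of_real ((cmod (G u (w i)))\<^sup>2))"
    by (intro sum.cong refl) (simp add: commute[of "w _" u] complex_norm_square del: of_real_power)
  finally show ?thesis by simp
qed

text \<open>Riesz representation in coordinates: expand \<open>u\<close> in the standard basis. The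
  conjugate cancels the one in the second slot of \<open>herm_inner\<close>.\<close>

lemma representing_vector:
  "G u w = herm_inner u (\<chi> j. cnj (G (axis j 1) w))"
proof -
  have "G u w = G (\<Sum>i\<in>UNIV. u $ i *s axis i 1) w"
    by (simp only: basis_expansion)
  then show ?thesis
    by (simp add: sum_left scale_left herm_inner_def)
qed

text \<open>Let \<open>w\<close> be orthonormal for \<open>G\<close> and let \<open>v i\<close>
  represent the functional \<open>G _ (w i)\<close>. Then \<open>w\<close> and \<open>v\<close> are
  biorthogonal for the standard product, and Parseval becomes the expression in the support function
  of an ellipsoid.\<close>

lemma dual_basis_exists:
  obtains w v where
    "\<And>u. u = (\<Sum>i<CARD('n). herm_inner u (v i) *s w i)"
    "\<And>i j. i < CARD('n) \<Longrightarrow> j < CARD('n) \<Longrightarrow> herm_inner (w i) (v j) = (if i = j then 1 else 0)"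
    "\<And>u. Re (G u u) = (\<Sum>i<CARD('n). (cmod (herm_inner u (v i)))\<^sup>2)"
proof -
  obtain w where w: "orthonormal CARD('n) w" using orthonormal_exists by blast
  define v where "v i = (\<chi> j. cnj (G (axis j 1) (w i)))" for i
  have v: "herm_inner u (v i) = G u (w i)" for u i
    by (simp add: v_def representing_vector[symmetric])
  show thesis
    by (rule that[of v w]; unfold v)
       (fact orthonormal_expansion[OF w] form_orthonormal_expansion[OF w] orthonormalD[OF w])+
qed

end

section \<open>Recovering an ellipsoid from its support function\<close>

lemma complex_ellipsoid_dual_basis:
  fixes v w :: "nat \<Rightarrow> complex^'n"
  assumes exp: "\<And>u. u = (\<Sum>i<CARD('n). herm_inner u (v i) *s w i)"
    and dual: "\<And>i j. i < CARD('n) \<Longrightarrow> j < CARD('n) \<Longrightarrow>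
      herm_inner (w i) (v j) = (if i = j then 1 else 0)"
  shows "complex_ellipsoid_in UNIV
    {x. \<forall>u. x \<bullet> u \<le> c \<bullet> u + sqrt (\<Sum>i<CARD('n). (cmod (herm_inner u (v i)))\<^sup>2)}"
    (is "complex_ellipsoid_in UNIV ?E")
proof -
  let ?n = "CARD('n)"
  let ?S = "{..<?n} \<rightarrow>\<^sub>E (UNIV :: complex set)"
  let ?f = "\<lambda>z. c + (\<Sum>j<?n. z j *s v j)"
  have coord: "herm_inner (\<Sum>j<?n. z j *s v j) (w i) = z i" if "i < ?n" for z i
  proof -
    have "herm_inner (\<Sum>j<?n. z j *s v j) (w i) = (\<Sum>j<?n. if i = j then z j else 0)"
      unfolding herm_inner_sum_left herm_inner_scale_left herm_inner_commute[of "v _" "w i"]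
      using that by (intro sum.cong refl) (simp add: dual)
    then show ?thesis using that by simp
  qed
  \<comment> \<open>The adjoint of \<open>exp\<close>, with the two bases exchanged: both sides have
    the same product with every \<open>u\<close>.\<close>
  have exp': "y = (\<Sum>i<?n. herm_inner y (w i) *s v i)" (is "_ = ?y") for y
  proof -
    have *: "herm_inner y u = herm_inner ?y u" for u
    proof -
      have "herm_inner y u = herm_inner y (\<Sum>i<?n. herm_inner u (v i) *s w i)"
        using exp[of u] by (rule arg_cong)
      then show ?thesis
        by (simp add: herm_inner_sum_right herm_inner_sum_left herm_inner_scale_left
          herm_inner_scale_right herm_inner_commute[of "v _" u] mult.commute)
    qed
    have "herm_inner (y - ?y) (y - ?y) = 0"
      unfolding herm_inner_diff_left right_minus_eq by (rule *)
    then have "(y - ?y) \<bullet> (y - ?y) = 0"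
      unfolding Re_herm_inner[symmetric] by (simp only: zero_complex.sel)
    then show ?thesis by (simp only: inner_eq_zero_iff right_minus_eq)
  qed
  have "inj_on ?f ?S"
  proof (rule inj_onI)
    fix z z' assume z: "z \<in> ?S" "z' \<in> ?S" "?f z = ?f z'"
    then have "z i = z' i" if "i < ?n" for i
      using coord[OF that, of z] coord[OF that, of z'] by simp
    then show "z = z'" using z by (intro PiE_ext[of z]) auto
  qed
  moreover have "?E = ?f ` {z \<in> ?S. (\<Sum>j<?n. (cmod (z j))\<^sup>2) \<le> 1}"
  proof (intro equalityI subsetI)
    fix x assume "x \<in> ?E"
    then have x: "(x - c) \<bullet> u \<le> sqrt (\<Sum>i<?n. (cmod (herm_inner u (v i)))\<^sup>2)" for u
      by (simp add: inner_diff_left algebra_simps)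
    define z where "z = (\<lambda>i\<in>{..<?n}. herm_inner (x - c) (w i))"
    define s where "s = (\<Sum>i<?n. (cmod (z i))\<^sup>2)"
    have zx: "x - c = (\<Sum>i<?n. z i *s v i)"
      by (subst exp') (simp add: z_def)
    \<comment> \<open>The test direction whose products with the \<open>v j\<close> are the
      coordinates \<open>z j\<close> of \<open>x - c\<close>. The support inequality at this
      \<open>u\<close> reads \<open>s \<le> sqrt s\<close>, which forces
      \<open>s \<le> 1\<close>.\<close>
    define u where "u = (\<Sum>i<?n. z i *s w i)"
    have uv: "herm_inner u (v j) = z j" if "j < ?n" for j
    proof -
      have "herm_inner u (v j) = (\<Sum>i<?n. if i = j then z i else 0)"
        unfolding u_def herm_inner_sum_left herm_inner_scale_left
        using that by (intro sum.cong refl) (simp add: dual)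
      then show ?thesis using that by simp
    qed
    have "herm_inner (x - c) u = (\<Sum>i<?n. complex_of_real ((cmod (z i))\<^sup>2))"
      unfolding zx using uv
      by (simp add: herm_inner_sum_left herm_inner_scale_left herm_inner_commute[of "v _" u]
        complex_norm_square del: of_real_power)
    then have "(x - c) \<bullet> u = s"
      by (simp add: Re_herm_inner[symmetric] s_def)
    moreover have "(\<Sum>i<?n. (cmod (herm_inner u (v i)))\<^sup>2) = s"
      using uv by (simp add: s_def)
    ultimately have le: "s \<le> sqrt s" using x[of u] by simp
    have "s \<le> 1"
    proof (rule ccontr)
      assume "\<not> s \<le> 1"
      then have "sqrt s < s"
        by (intro real_less_lsqrt) (auto simp: power2_eq_square)
      with le show False by simp
    qed
    then have "z \<in> {z \<in> ?S. (\<Sum>j<?n. (cmod (z j))\<^sup>2) \<le> 1}"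
      unfolding s_def by (simp add: z_def del: restrict_apply)
    moreover have "x = ?f z" unfolding zx[symmetric] by simp
    ultimately show "x \<in> ?f ` {z \<in> ?S. (\<Sum>j<?n. (cmod (z j))\<^sup>2) \<le> 1}"
      by (intro image_eqI[of x ?f z])
  next
    fix x assume "x \<in> ?f ` {z \<in> ?S. (\<Sum>j<?n. (cmod (z j))\<^sup>2) \<le> 1}"
    then show "x \<in> ?E"
      unfolding image_iff mem_Collect_eq
      by (elim bexE) (simp add: inner_add_left inner_combination_le)
  qed
  ultimately show ?thesis
    unfolding complex_ellipsoid_in_def vec_dim_card Let_def by blast
qed

section \<open>Gluing Hermitian forms on two-dimensional subspaces\<close>

text \<open>The Jordan--von Neumann argument: additivity of the polarization is the only property
  involving three vectors, and it follows from the parallelogram law.\<close>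

lemma polarization_additive:
  fixes Q :: "'a::real_vector \<Rightarrow> real"
  assumes par: "\<And>x y. Q (x + y) + Q (x - y) = 2 * Q x + 2 * Q y"
  shows "Q (x + y + z) - Q (x + y - z) = (Q (x + z) - Q (x - z)) + (Q (y + z) - Q (y - z))"
proof -
  \<comment> \<open>The difference of the parallelogram laws at \<open>a + z\<close> and
    \<open>a - z\<close>, both with increment \<open>b\<close>.\<close>
  have mid: "(Q (a + b + z) - Q (a + b - z)) + (Q (a - b + z) - Q (a - b - z))
      = 2 * (Q (a + z) - Q (a - z))" for a b
    using par[of "a + z" b] par[of "a - z" b] by (simp add: algebra_simps)
  have zero: "Q (0 + z) - Q (0 - z) = 0"
    using par[of 0 z] par[of 0 0] by simp
  \<comment> \<open>With these halves, \<open>mid a b\<close> yields the right-hand side of the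
    claim and \<open>mid a a\<close> the left-hand side, both equal to
    \<open>2 * (Q (a + z) - Q (a - z))\<close>.\<close>
  define a b where "a = (1/2) *\<^sub>R (x + y)" and "b = (1/2) *\<^sub>R (x - y)"
  have ab: "a + b = x" "a - b = y" "a + a = x + y" "a - a = 0"
    by (simp_all add: a_def b_def algebra_simps flip: scaleR_add_left)
  show ?thesis
    using mid[of a b] mid[of a a] zero unfolding ab by linarith
qed

text \<open>Here \<open>m\<close> and \<open>v\<close> may vary with the pair. Homogeneity, symmetry
  and the parallelogram law involve two vectors only, so they can be read off on each pair;
  additivity then follows from the parallelogram law.\<close>

lemma pos_herm_form_of_pairs:
  fixes Q :: "complex^'n \<Rightarrow> real"
  assumes pair: "\<And>x y. \<exists>m (v :: nat \<Rightarrow> complex^'n). \<forall>a b.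
      Q (a *s x + b *s y) = (\<Sum>j<m. (cmod (herm_inner (a *s x + b *s y) (v j)))\<^sup>2)"
    and pos: "\<And>x. x \<noteq> 0 \<Longrightarrow> Q x > 0"
  obtains G where "pos_herm_form G" "\<And>x. Re (G x x) = Q x"
proof -
  \<comment> \<open>Complex polarization, with signs chosen to make \<open>G\<close> linear in its
    first argument.\<close>
  define G where "G x y = complex_of_real ((Q (x + y) - Q (x - y)) / 4)
    + \<i> * complex_of_real ((Q (x + \<i> *s y) - Q (x - \<i> *s y)) / 4)" for x y
  have par: "Q (x + y) + Q (x - y) = 2 * Q x + 2 * Q y" for x y
  proof -
    obtain m and v :: "nat \<Rightarrow> complex^'n" where
      v: "\<And>a b. Q (a *s x + b *s y) = (\<Sum>j<m. (cmod (herm_inner (a *s x + b *s y) (v j)))\<^sup>2)"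
      using pair by metis
    have Qs: "Q (x + y) = (\<Sum>j<m. (cmod (herm_inner x (v j) + herm_inner y (v j)))\<^sup>2)"
      "Q (x - y) = (\<Sum>j<m. (cmod (herm_inner x (v j) - herm_inner y (v j)))\<^sup>2)"
      "Q x = (\<Sum>j<m. (cmod (herm_inner x (v j)))\<^sup>2)"
      "Q y = (\<Sum>j<m. (cmod (herm_inner y (v j)))\<^sup>2)"
      using v[of 1 1] v[of 1 "-1"] v[of 1 0] v[of 0 1]
      by (simp_all add: herm_inner_add_left herm_inner_diff_left)
    have "(cmod (s + t))\<^sup>2 + (cmod (s - t))\<^sup>2 = 2 * (cmod s)\<^sup>2 + 2 * (cmod t)\<^sup>2" for s t
      unfolding cmod_power2 by (simp add: power2_eq_square algebra_simps)
    then show ?thesis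
      unfolding Qs sum_distrib_left by (simp flip: sum.distrib)
  qed
  \<comment> \<open>The same polarization for scalars; summed over \<open>j\<close> it identifies
    \<open>G\<close> on the span of \<open>x\<close> and \<open>y\<close> with an explicit Hermitian
    form.\<close>
  have polar: "complex_of_real (((cmod (s + t))\<^sup>2 - (cmod (s - t))\<^sup>2) / 4)
    + \<i> * complex_of_real (((cmod (s + \<i> * t))\<^sup>2 - (cmod (s - \<i> * t))\<^sup>2) / 4) = s * cnj t" for s t
    unfolding cmod_power2 by (simp add: complex_eq_iff power2_eq_square field_simps)
  have G_pair: "\<exists>m (v :: nat \<Rightarrow> complex^'n). \<forall>a b c d.
      G (a *s x + b *s y) (c *s x + d *s y) =
        (\<Sum>j<m. herm_inner (a *s x + b *s y) (v j) * cnj (herm_inner (c *s x + d *s y) (v j)))"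
    for x y
  proof -
    obtain m and v :: "nat \<Rightarrow> complex^'n" where
      v: "\<And>a b. Q (a *s x + b *s y) = (\<Sum>j<m. (cmod (herm_inner (a *s x + b *s y) (v j)))\<^sup>2)"
      using pair by metis
    have "G (a *s x + b *s y) (c *s x + d *s y) =
        (\<Sum>j<m. herm_inner (a *s x + b *s y) (v j) * cnj (herm_inner (c *s x + d *s y) (v j)))"
      for a b c d
    proof -
      let ?X = "a *s x + b *s y" and ?Y = "c *s x + d *s y"
      have comb: "?X + ?Y = (a + c) *s x + (b + d) *s y"
        "?X - ?Y = (a - c) *s x + (b - d) *s y"
        "?X + \<i> *s ?Y = (a + \<i> * c) *s x + (b + \<i> * d) *s y"
        "?X - \<i> *s ?Y = (a - \<i> * c) *s x + (b - \<i> * d) *s y"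
        by (simp_all add: vec_eq_iff algebra_simps)
      have Qs: "Q (?X + ?Y) = (\<Sum>j<m. (cmod (herm_inner ?X (v j) + herm_inner ?Y (v j)))\<^sup>2)"
        "Q (?X - ?Y) = (\<Sum>j<m. (cmod (herm_inner ?X (v j) - herm_inner ?Y (v j)))\<^sup>2)"
        "Q (?X + \<i> *s ?Y) = (\<Sum>j<m. (cmod (herm_inner ?X (v j) + \<i> * herm_inner ?Y (v j)))\<^sup>2)"
        "Q (?X - \<i> *s ?Y) = (\<Sum>j<m. (cmod (herm_inner ?X (v j) - \<i> * herm_inner ?Y (v j)))\<^sup>2)"
        using v[of "a + c" "b + d"] v[of "a - c" "b - d"] v[of "a + \<i> * c" "b + \<i> * d"]
          v[of "a - \<i> * c" "b - \<i> * d"]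
        unfolding comb[symmetric]
        by (simp_all only: herm_inner_add_left[of ?X] herm_inner_diff_left[of ?X]
          herm_inner_scale_left[of \<i> ?Y])
      show ?thesis
        unfolding G_def Qs polar[symmetric]
        by (simp only: sum_subtractf[symmetric] sum_divide_distrib sum.distrib of_real_sum
          sum_distrib_left)
    qed
    then show ?thesis by blast
  qed
  have scale: "G (a *s x) y = a * G x y" for a x y
  proof -
    obtain m and v :: "nat \<Rightarrow> complex^'n" where
      v: "\<And>a b c d. G (a *s x + b *s y) (c *s x + d *s y) =
        (\<Sum>j<m. herm_inner (a *s x + b *s y) (v j) * cnj (herm_inner (c *s x + d *s y) (v j)))"
      using G_pair by metis
    show ?thesis
      using v[of a 0 0 1] v[of 1 0 0 1]
      by (simp add: herm_inner_scale_left sum_distrib_left mult.assoc)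
  qed
  have comm: "G x y = cnj (G y x)" for x y
  proof -
    obtain m and v :: "nat \<Rightarrow> complex^'n" where
      v: "\<And>a b c d. G (a *s x + b *s y) (c *s x + d *s y) =
        (\<Sum>j<m. herm_inner (a *s x + b *s y) (v j) * cnj (herm_inner (c *s x + d *s y) (v j)))"
      using G_pair by metis
    show ?thesis
      using v[of 1 0 0 1] v[of 0 1 1 0] by (simp add: mult.commute)
  qed
  have self: "Re (G x x) = Q x" for x
    \<comment> \<open>The law at \<open>0, 0\<close> gives \<open>Q 0 = 0\<close>, and at
      \<open>x, x\<close> it then gives \<open>Q (x + x) = 4 * Q x\<close>; the factor 4 cancels the
      denominator in \<open>G\<close>.\<close>
    using par[of x x] par[of 0 0] by (simp add: G_def)
  have "pos_herm_form G"
  proof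
    show "G (x + y) z = G x z + G y z" for x y z
      unfolding G_def polarization_additive[OF par, of x y]
      by (simp add: add_divide_distrib diff_divide_distrib algebra_simps)
    show "G (a *s x) z = a * G x z" for a x z by (rule scale)
    show "G x y = cnj (G y x)" for x y by (rule comm)
    show "Re (G x x) > 0" if "x \<noteq> 0" for x using pos[OF that] by (simp only: self)
  qed
  with self show thesis using that by blast
qed

section \<open>From ellipsoidal projections to an ellipsoid\<close>

theorem theorem4p2:
  fixes K :: "(complex^'n) set" and k :: nat
  assumes "2 \<le> k" and "k < CARD('n)"
    and "compact K" and "convex K" and "interior K \<noteq> {}"
    and "\<forall>P. vec.subspace P \<and> vec.dim P = k \<longrightarrow> complex_ellipsoid_in P (cproj P ` K)"
  shows "complex_ellipsoid_in UNIV K"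
proof -
  define h where "h = support_fun K"
  \<comment> \<open>The odd and even parts of \<open>h\<close> separate the linear term of an
    ellipsoid's support function from the square root. The \<open>c\<close> and \<open>v\<close>
    found below depend on the pair \<open>x\<close>, \<open>y\<close>.\<close>
  define od where "od u = (h u - h (- u)) / 2" for u
  define N where "N u = (h u + h (- u)) / 2" for u
  have pair: "\<exists>c (v :: nat \<Rightarrow> complex^'n). \<forall>a b.
      od (a *s x + b *s y) = c \<bullet> (a *s x + b *s y) \<and>
      N (a *s x + b *s y) = sqrt (\<Sum>j<k. (cmod (herm_inner (a *s x + b *s y) (v j)))\<^sup>2)" for x y
  proof -
    obtain P where P: "vec.subspace P" "vec.dim P = k" "x \<in> P" "y \<in> P"
      using exists_subspace_containing_pair[of k x y] assms(1,2) by auto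
    obtain c and v :: "nat \<Rightarrow> complex^'n" where
      "\<And>u. support_fun (cproj P ` K) u = c \<bullet> u + sqrt (\<Sum>j<k. (cmod (herm_inner u (v j)))\<^sup>2)"
      using support_fun_ellipsoid[of P "cproj P ` K"] assms(6) P by metis
    then have h: "h u = c \<bullet> u + sqrt (\<Sum>j<k. (cmod (herm_inner u (v j)))\<^sup>2)" if "u \<in> P" for u
      using support_fun_cproj[OF P(1) that, of K] by (simp add: h_def)
    have "od u = c \<bullet> u \<and> N u = sqrt (\<Sum>j<k. (cmod (herm_inner u (v j)))\<^sup>2)" if "u \<in> P" for u
    proof -
      have "- u \<in> P" using P(1) that by (rule vec.subspace_neg)
      moreover have "herm_inner (- u) (v j) = - herm_inner u (v j)" for j
        using herm_inner_diff_left[of 0 u] by simp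
      ultimately show ?thesis using h[OF that] h[of "- u"] by (simp add: od_def N_def)
    qed
    moreover have "a *s x + b *s y \<in> P" for a b
      using P by (simp add: vec.subspace_add vec.subspace_scale)
    ultimately show ?thesis by blast
  qed

  have "linear od"
  proof
    fix x y :: "complex^'n" and r :: real
    obtain c where c: "\<And>a b. od (a *s x + b *s y) = c \<bullet> (a *s x + b *s y)"
      using pair by metis
    show "od (x + y) = od x + od y"
      using c[of 1 1] c[of 1 0] c[of 0 1] by (simp add: inner_add_right)
    show "od (r *\<^sub>R x) = r *\<^sub>R od x"
      using c[of "of_real r" 0] c[of 1 0] by (simp flip: scaleR_eq_scale_of_real)
  qed
  \<comment> \<open>\<open>adjoint od 1\<close> is the vector representing the linear functional
    \<open>od\<close>; it becomes the centre of the ellipsoid.\<close>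
  then have od: "od u = adjoint od 1 \<bullet> u" for u
    using adjoint_works[of od u 1] by (simp add: inner_commute)

  obtain x0 e where e: "e > 0" "ball x0 e \<subseteq> K"
    using assms(5) by (meson ex_in_conv mem_interior)
  have Npos: "N u > 0" if "u \<noteq> 0" for u
  proof -
    \<comment> \<open>Makes \<open>t *\<^sub>R u\<close> have norm \<open>e / 2\<close>, so a
      segment in direction \<open>u\<close> fits inside \<open>K\<close>; hence the width
      \<open>h u + h (- u)\<close> is at least \<open>t * (u \<bullet> u)\<close>.\<close>
    define t where "t = e / (2 * norm u)"
    have t: "t > 0" using e that by (simp add: t_def)
    have "norm (t *\<^sub>R u) < e" using e that by (simp add: t_def)
    then have "x0 + t *\<^sub>R u \<in> K" "x0 \<in> K"
      using e by (auto simp: dist_norm intro!: subsetD[OF e(2)])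
    then have "(x0 + t *\<^sub>R u) \<bullet> u \<le> h u" "x0 \<bullet> (- u) \<le> h (- u)"
      unfolding h_def by (blast intro: inner_le_support_fun[OF assms(3)])+
    moreover have "t * (u \<bullet> u) > 0" using t that by simp
    ultimately show ?thesis by (simp add: N_def inner_add_left)
  qed

  have N_pair: "\<exists>m (v :: nat \<Rightarrow> complex^'n). \<forall>a b.
      (N (a *s x + b *s y))\<^sup>2 = (\<Sum>j<m. (cmod (herm_inner (a *s x + b *s y) (v j)))\<^sup>2)" for x y
  proof -
    obtain v :: "nat \<Rightarrow> complex^'n" where "\<And>a b.
      N (a *s x + b *s y) = sqrt (\<Sum>j<k. (cmod (herm_inner (a *s x + b *s y) (v j)))\<^sup>2)"
      using pair by metis
    then show ?thesis by (intro exI[of _ k] exI[of _ v]) (simp add: sum_nonneg)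
  qed
  obtain G where G: "pos_herm_form G" "\<And>x. Re (G x x) = (N x)\<^sup>2"
  proof (rule pos_herm_form_of_pairs[of "\<lambda>x. (N x)\<^sup>2", OF N_pair zero_less_power[OF Npos]])
    fix G assume "pos_herm_form G" "\<And>x. Re (G x x) = (N x)\<^sup>2"
    then show thesis by (rule that)
  qed
  interpret pos_herm_form G by (fact G(1))
  obtain w v where wv:
    "\<And>u. u = (\<Sum>i<CARD('n). herm_inner u (v i) *s w i)"
    "\<And>i j. i < CARD('n) \<Longrightarrow> j < CARD('n) \<Longrightarrow> herm_inner (w i) (v j) = (if i = j then 1 else 0)"
    "\<And>u. Re (G u u) = (\<Sum>i<CARD('n). (cmod (herm_inner u (v i)))\<^sup>2)"
    by (rule dual_basis_exists) (rule that)
  \<comment> \<open>\<open>Npos\<close> leaves out \<open>u = 0\<close>; nonnegativity everywhere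
    allows the square root of \<open>(N u)\<^sup>2\<close> to be taken.\<close>
  have "N u \<ge> 0" for u
  proof -
    obtain v :: "nat \<Rightarrow> complex^'n" where "\<And>a b.
      N (a *s u + b *s u) = sqrt (\<Sum>j<k. (cmod (herm_inner (a *s u + b *s u) (v j)))\<^sup>2)"
      using pair by metis
    from this[of 1 0] show ?thesis by (simp add: sum_nonneg)
  qed
  then have "N u = sqrt (\<Sum>i<CARD('n). (cmod (herm_inner u (v i)))\<^sup>2)" for u
    unfolding wv(3)[symmetric] G(2) by simp
  moreover have "h u = od u + N u" for u by (simp add: od_def N_def field_simps)
  ultimately have h: "h u = adjoint od 1 \<bullet> u +
      sqrt (\<Sum>i<CARD('n). (cmod (herm_inner u (v i)))\<^sup>2)" for u
    using od by simp
  have "K \<noteq> {}" using assms(5) by auto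
  \<comment> \<open>A nonempty compact convex set is the intersection of its supporting half-spaces,
    so it is determined by \<open>h\<close>.\<close>
  then have "K = {x. \<forall>u. x \<bullet> u \<le> h u}"
    using inner_le_support_fun[OF assms(3)] mem_if_inner_le_support_fun[OF assms(3,4)]
    by (auto simp: h_def)
  moreover have "complex_ellipsoid_in UNIV {x. \<forall>u. x \<bullet> u \<le> h u}"
    unfolding h using wv(1,2) by (rule complex_ellipsoid_dual_basis)
  ultimately show ?thesis by simp
qed

end
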